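(* Let $U_1,\dots,U_m\subset\mathbb{R}^n$ be closed convex sets with $S:=\bigcap_{i=1}^mU_i\neq\varnothing$, and let $$T_{\mathrm{Cim}}x:=\frac1m\sum_{k=1}^mP_{U_k}x,\qquad x\in\mathbb{R}^n .$$ Then for all $s\in S$ and all $x\in\mathbb{R}^n$, $$\|T_{\mathrm{Cim}}x-s\|^2\le\|x-s\|^2-\frac1m\,\delta(x)^2 .$$
   Context: $P_{U}$ denotes the metric projection onto the closed convex set $U$ and $\delta(x):=\max_{1\le i\le m}\mathrm{dist}(x,U_i)$; $\|\cdot\|$ is the Euclidean norm. *)

theory Defs
  imports "HOL-Analysis.Analysis"
begin

text \<open>The metric projection onto a nonempty closed convex set \<open>C\<close> is the library's
  \<^const>\<open>closest_point\<close> \<open>C\<close>, and the distance to it is \<open>infdist x C\<close>. The sets are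
  \<open>U 1, \<dots>, U m\<close>; values of \<open>U\<close> outside \<open>{1..m}\<close> are irrelevant.\<close>

definition cimmino :: "nat \<Rightarrow> (nat \<Rightarrow> (real ^ 'n) set) \<Rightarrow> real ^ 'n \<Rightarrow> real ^ 'n" where
  "cimmino m U x = (1 / real m) *\<^sub>R (\<Sum>k\<in>{1..m}. closest_point (U k) x)"

definition max_dist :: "nat \<Rightarrow> (nat \<Rightarrow> (real ^ 'n) set) \<Rightarrow> real ^ 'n \<Rightarrow> real" where
  "max_dist m U x = (MAX i\<in>{1..m}. infdist x (U i))"

end

theory Submission
  imports Defs
begin

text \<open>Each projection is firmly quasi-nonexpansive: passing from \<open>x\<close> to its projection onto a
  convex set containing \<open>s\<close> lowers the squared distance to \<open>s\<close> by at least the squared distance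
  from \<open>x\<close> to the set. The squared norm of a mean is at most the mean of the squared norms, so
  averaging the projections lowers the squared distance to \<open>s\<close> by at least the mean of the
  squared distances to the sets. That mean is at least \<open>1 / m\<close> times the largest of them.\<close>

text \<open>The angle at the projection between \<open>x\<close> and \<open>s\<close> is right or obtuse, so the cross term in
  the expansion of \<open>x - s = (x - p) + (p - s)\<close>, with \<open>p\<close> the projection, is nonnegative.\<close>

lemma closest_point_firmly_quasi_nonexpansive:
  fixes S :: "'a::euclidean_space set"
  assumes "closed S" "convex S" "s \<in> S"
  shows "(norm (closest_point S x - s))\<^sup>2 \<le> (norm (x - s))\<^sup>2 - (infdist x S)\<^sup>2"
proof -
  let ?p = "closest_point S x"
  have "?p \<in> S"
    using assms by (intro closest_point_in_set) auto
  then have "infdist x S \<le> norm (x - ?p)"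
    by (metis infdist_le dist_norm)
  then have "(infdist x S)\<^sup>2 \<le> (norm (x - ?p))\<^sup>2"
    by (simp add: infdist_nonneg power_mono)
  moreover have "(x - ?p) \<bullet> (s - ?p) \<le> 0"
    using assms by (intro closest_point_dot)
  moreover have "(norm (x - s))\<^sup>2 =
      (norm (x - ?p))\<^sup>2 + (norm (?p - s))\<^sup>2 - 2 * ((x - ?p) \<bullet> (s - ?p))"
    unfolding power2_norm_eq_inner by (simp add: inner_diff inner_commute)
  ultimately show ?thesis
    by linarith
qed

lemma norm_sum_squared_le:
  fixes f :: "'i \<Rightarrow> 'a::real_normed_vector"
  shows "(norm (\<Sum>i\<in>A. f i))\<^sup>2 \<le> (\<Sum>i\<in>A. (norm (f i))\<^sup>2) * real (card A)"
proof -
  have "(norm (\<Sum>i\<in>A. f i))\<^sup>2 \<le> (\<Sum>i\<in>A. norm (f i))\<^sup>2"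
    by (intro power_mono norm_sum norm_ge_zero)
  also have "\<dots> \<le> (\<Sum>i\<in>A. (norm (f i))\<^sup>2) * real (card A)"
    by (rule sum_squared_le_sum_of_squares)
  finally show ?thesis .
qed

theorem mainTheorem5:
  fixes U :: "nat \<Rightarrow> (real ^ 'n) set" and m :: nat
  assumes "m \<ge> 1"
    and "\<And>i. i \<in> {1..m} \<Longrightarrow> closed (U i)"
    and "\<And>i. i \<in> {1..m} \<Longrightarrow> convex (U i)"
    and "(\<Inter>i\<in>{1..m}. U i) \<noteq> {}"
  shows "\<forall>s\<in>(\<Inter>i\<in>{1..m}. U i). \<forall>x.
    (norm (cimmino m U x - s))\<^sup>2 \<le> (norm (x - s))\<^sup>2 - (1 / real m) * (max_dist m U x)\<^sup>2"
proof (intro ballI allI)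
  fix s x
  assume s: "s \<in> (\<Inter>i\<in>{1..m}. U i)"
  let ?P = "\<lambda>k. closest_point (U k) x"
  have m: "real m > 0"
    using \<open>m \<ge> 1\<close> by simp
  have "max_dist m U x \<in> (\<lambda>i. infdist x (U i)) ` {1..m}"
    unfolding max_dist_def using \<open>m \<ge> 1\<close> by (intro Max_in) auto
  then obtain j where j: "j \<in> {1..m}" "max_dist m U x = infdist x (U j)"
    by auto
  have "(norm (\<Sum>k\<in>{1..m}. ?P k - s))\<^sup>2 \<le> (\<Sum>k\<in>{1..m}. (norm (?P k - s))\<^sup>2) * real m"
    using norm_sum_squared_le[of "\<lambda>k. ?P k - s" "{1..m}"] by simp
  also have "\<dots> \<le> (\<Sum>k\<in>{1..m}. (norm (x - s))\<^sup>2 - (infdist x (U k))\<^sup>2) * real m"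
    using assms(2,3) s
    by (intro mult_right_mono sum_mono closest_point_firmly_quasi_nonexpansive) auto
  also have "\<dots> = (real m * (norm (x - s))\<^sup>2 - (\<Sum>k\<in>{1..m}. (infdist x (U k))\<^sup>2)) * real m"
    by (simp add: sum_subtractf)
  also have "\<dots> \<le> (real m * (norm (x - s))\<^sup>2 - (max_dist m U x)\<^sup>2) * real m"
    using member_le_sum[of j "{1..m}" "\<lambda>k. (infdist x (U k))\<^sup>2"] j
    by (intro mult_right_mono diff_left_mono) auto
  also have "\<dots> = (real m)\<^sup>2 * ((norm (x - s))\<^sup>2 - (1 / real m) * (max_dist m U x)\<^sup>2)"
    using m by (simp add: field_simps power2_eq_square)
  finally have "(norm (\<Sum>k\<in>{1..m}. ?P k - s))\<^sup>2 \<le>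
      (real m)\<^sup>2 * ((norm (x - s))\<^sup>2 - (1 / real m) * (max_dist m U x)\<^sup>2)" .
  moreover have "(\<Sum>k\<in>{1..m}. ?P k - s) = real m *\<^sub>R (cimmino m U x - s)"
    using m by (simp add: cimmino_def sum_subtractf scaleR_diff_right sum_constant_scaleR del: sum_constant)
  ultimately have "(real m)\<^sup>2 * (norm (cimmino m U x - s))\<^sup>2 \<le>
      (real m)\<^sup>2 * ((norm (x - s))\<^sup>2 - (1 / real m) * (max_dist m U x)\<^sup>2)"
    by (simp add: power_mult_distrib)
  then show "(norm (cimmino m U x - s))\<^sup>2 \<le>
      (norm (x - s))\<^sup>2 - (1 / real m) * (max_dist m U x)\<^sup>2"
    using m by (simp only: mult_le_cancel_left_pos zero_less_power)
qed

end
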